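(* Let $(H,\cdot,\Delta,\varepsilon,S)$ be a $\mathbb{Z}^n$-bigraded Hopf algebra (in the sense of the context) and let $\theta$ be a real skew-symmetric $n\times n$ matrix. Then by deforming the multiplication of $H$ to $\cdot_\Theta$ one obtains a new Hopf algebra $$H_\Theta=(H,\cdot_\Theta,\Delta,\varepsilon,S)$$ with the same coproduct, counit and antipode as $H$.
   Context: All algebras are over $\mathbb{C}$ and $\otimes=\otimes_{\mathbb{C}}$. A $\mathbb{Z}^n$-bigraded Hopf algebra is a Hopf algebra $H=\bigoplus_{r,s\in\mathbb{Z}^n}H_{(r,s)}$ such that: (i) $H_{(r,s)}\cdot H_{(p,q)}\subset H_{(r+p,s+q)}$; (ii) $\Delta(H_{(r,l)})\subset\bigoplus_{s\in\mathbb{Z}^n}H_{(r,s)}\otimes H_{(s,l)}$; (iii) $\varepsilon(h)=0$ for $h\in H_{(r,l)}$ with $r\ne l$; (iv) the antipode satisfies $S(H_{(r,l)})\subset H_{(-l,-r)}$ (and, if $H$ has a $*$-structure, $(H_{(r,l)})^*\subset H_{(-r,-l)}$). Let $\lambda_\theta(r,l)=e^{\pi i\langle\theta r,l\rangle}$ for $r,l\in\mathbb{Z}^n$, with $\langle\cdot,\cdot\rangle$ the standard pairing, and $\Theta=\begin{pmatrix}\theta&0\\0&-\theta\end{pmatrix}$. The deformed product is defined on homogeneous elements $h\in H_{(r_1,r_2)}$, $g\in H_{(l_1,l_2)}$ by $h\cdot_\Theta g=\lambda_\theta(r_1,l_1)\,\lambda_{-\theta}(r_2,l_2)\,hg$,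 extended bilinearly. *)

theory Defs
  imports "HOL-Analysis.Analysis" "HOL-Library.Poly_Mapping"
begin

section \<open>Complex vector spaces\<close>

class complex_vector = ab_group_add +
  fixes scaleC :: "complex \<Rightarrow> 'a \<Rightarrow> 'a" (infixr \<open>*\<^sub>C\<close> 75)
  assumes scaleC_add_right: "a *\<^sub>C (x + y) = a *\<^sub>C x + a *\<^sub>C y"
    and scaleC_add_left: "(a + b) *\<^sub>C x = a *\<^sub>C x + b *\<^sub>C x"
    and scaleC_scaleC: "a *\<^sub>C b *\<^sub>C x = (a * b) *\<^sub>C x"
    and scaleC_one: "1 *\<^sub>C x = x"

global_interpretation cvec: vector_space "scaleC :: complex \<Rightarrow> 'a \<Rightarrow> 'a::complex_vector"
  by unfold_locales (simp_all add: scaleC_add_right scaleC_add_left scaleC_scaleC scaleC_one)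

instantiation complex :: complex_vector
begin
definition scaleC_complex :: "complex \<Rightarrow> complex \<Rightarrow> complex" where
  "scaleC_complex = (*)"
instance
  by intro_classes (simp_all add: scaleC_complex_def algebra_simps)
end

instantiation poly_mapping :: (type, complex_vector) complex_vector
begin
definition scaleC_poly_mapping :: "complex \<Rightarrow> ('a \<Rightarrow>\<^sub>0 'b) \<Rightarrow> ('a \<Rightarrow>\<^sub>0 'b)" where
  "scaleC_poly_mapping c = Poly_Mapping.map (scaleC c)"

lemma lookup_scaleC: "Poly_Mapping.lookup (c *\<^sub>C p) k = c *\<^sub>C Poly_Mapping.lookup p k"
  for p :: "'a \<Rightarrow>\<^sub>0 'b"
  by (simp add: scaleC_poly_mapping_def map.rep_eq when_def)

instance
  by intro_classes
    (rule poly_mapping_eqI;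
     simp add: lookup_scaleC lookup_add scaleC_add_right scaleC_add_left scaleC_scaleC scaleC_one)+
end

abbreviation clinear :: "('a::complex_vector \<Rightarrow> 'b::complex_vector) \<Rightarrow> bool" where
  "clinear \<equiv> Vector_Spaces.linear scaleC scaleC"

definition cbilinear :: "('a::complex_vector \<Rightarrow> 'b::complex_vector \<Rightarrow> 'c::complex_vector) \<Rightarrow> bool" where
  "cbilinear b \<longleftrightarrow> (\<forall>x. clinear (b x)) \<and> (\<forall>y. clinear (\<lambda>x. b x y))"

lemma clinearI:
  assumes "\<And>x y. f (x + y) = f x + f y" "\<And>c x. f (c *\<^sub>C x) = c *\<^sub>C f x"
  shows "clinear f"
  using assms by unfold_locales auto

lemma clinearD:
  assumes "clinear f"
  shows "f (x + y) = f x + f y" "f (c *\<^sub>C x) = c *\<^sub>C f x"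
proof -
  interpret Vector_Spaces.linear scaleC scaleC f by fact
  show "f (x + y) = f x + f y" "f (c *\<^sub>C x) = c *\<^sub>C f x" by (simp_all add: add scale)
qed

section \<open>The algebraic tensor product over the complex numbers\<close>

inductive_set tensor_relations ::
    "('a::complex_vector \<times> 'b::complex_vector \<Rightarrow>\<^sub>0 complex) set" where
  "Poly_Mapping.single (x + x', y) 1 - Poly_Mapping.single (x, y) 1 - Poly_Mapping.single (x', y) 1
     \<in> tensor_relations"
| "Poly_Mapping.single (x, y + y') 1 - Poly_Mapping.single (x, y) 1 - Poly_Mapping.single (x, y') 1
     \<in> tensor_relations"
| "Poly_Mapping.single (c *\<^sub>C x, y) 1 - c *\<^sub>C Poly_Mapping.single (x, y) 1 \<in> tensor_relations"
| "Poly_Mapping.single (x, c *\<^sub>C y) 1 - c *\<^sub>C Poly_Mapping.single (x, y) 1 \<in> tensor_relations"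

quotient_type (overloaded) ('a, 'b) tensor =
    "('a::complex_vector \<times> 'b::complex_vector) \<Rightarrow>\<^sub>0 complex" /
    "\<lambda>p q. p - q \<in> cvec.span tensor_relations"
proof (rule equivpI)
  show "reflp (\<lambda>p q. p - q \<in> cvec.span (tensor_relations :: ('a \<times> 'b \<Rightarrow>\<^sub>0 complex) set))"
    by (rule reflpI) (simp add: cvec.span_zero)
  show "symp (\<lambda>p q. p - q \<in> cvec.span (tensor_relations :: ('a \<times> 'b \<Rightarrow>\<^sub>0 complex) set))"
    by (rule sympI) (drule cvec.span_neg, simp)
  show "transp (\<lambda>p q. p - q \<in> cvec.span (tensor_relations :: ('a \<times> 'b \<Rightarrow>\<^sub>0 complex) set))"
    by (rule transpI) (drule (1) cvec.span_add, simp)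
qed

instantiation tensor :: (complex_vector, complex_vector) complex_vector
begin

lift_definition zero_tensor :: "('a, 'b) tensor" is 0 .

lift_definition plus_tensor :: "('a, 'b) tensor \<Rightarrow> ('a, 'b) tensor \<Rightarrow> ('a, 'b) tensor" is "(+)"
  by (drule (1) cvec.span_add) (simp add: add_diff_add)

lift_definition uminus_tensor :: "('a, 'b) tensor \<Rightarrow> ('a, 'b) tensor" is uminus
  by (drule cvec.span_neg) simp

lift_definition minus_tensor :: "('a, 'b) tensor \<Rightarrow> ('a, 'b) tensor \<Rightarrow> ('a, 'b) tensor" is "(-)"
  by (drule (1) cvec.span_diff) (simp add: algebra_simps)

lift_definition scaleC_tensor :: "complex \<Rightarrow> ('a, 'b) tensor \<Rightarrow> ('a, 'b) tensor" is scaleC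
  by (simp add: cvec.scale_right_diff_distrib[symmetric] cvec.span_scale)

instance
proof
  fix x y z :: "('a, 'b) tensor" and a b :: complex
  show "x + y + z = x + (y + z)" by transfer (simp add: cvec.span_zero add.assoc)
  show "x + y = y + x" by transfer (simp add: cvec.span_zero add.commute)
  show "0 + x = x" by transfer (simp add: cvec.span_zero)
  show "- x + x = 0" by transfer (simp add: cvec.span_zero)
  show "x - y = x + - y" by transfer (simp add: cvec.span_zero)
  show "a *\<^sub>C (x + y) = a *\<^sub>C x + a *\<^sub>C y"
    by transfer (simp add: cvec.span_zero scaleC_add_right)
  show "(a + b) *\<^sub>C x = a *\<^sub>C x + b *\<^sub>C x"
    by transfer (simp add: cvec.span_zero scaleC_add_left)
  show "a *\<^sub>C b *\<^sub>C x = (a * b) *\<^sub>C x"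
    by transfer (simp add: cvec.span_zero scaleC_scaleC)
  show "1 *\<^sub>C x = x" by transfer (simp add: cvec.span_zero scaleC_one)
qed

end

lift_definition tens :: "'a::complex_vector \<Rightarrow> 'b::complex_vector \<Rightarrow> ('a, 'b) tensor" (infixr \<open>\<otimes>\<close> 70)
  is "\<lambda>x y. Poly_Mapping.single (x, y) 1" .

text \<open>The linear map on the tensor product induced by a bilinear map \<open>b\<close>. The choice of representative
  is irrelevant when \<open>b\<close> is bilinear, and only then is this the map of the universal property; see
  \<open>clinear_tensor_lift\<close>, \<open>tensor_lift_tens\<close> and \<open>tensor_lift_unique\<close> below.\<close>

definition free_lift :: "('a \<Rightarrow> 'b \<Rightarrow> 'c::complex_vector) \<Rightarrow> ('a \<times> 'b \<Rightarrow>\<^sub>0 complex) \<Rightarrow> 'c" where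
  "free_lift b p = (\<Sum>(x, y)\<in>Poly_Mapping.keys p. Poly_Mapping.lookup p (x, y) *\<^sub>C b x y)"

definition tensor_lift ::
    "('a::complex_vector \<Rightarrow> 'b::complex_vector \<Rightarrow> 'c::complex_vector) \<Rightarrow> ('a, 'b) tensor \<Rightarrow> 'c" where
  "tensor_lift b t = free_lift b (rep_tensor t)"

lemma free_lift_superset:
  assumes "finite A" "Poly_Mapping.keys p \<subseteq> A"
  shows "free_lift b p = (\<Sum>(x, y)\<in>A. Poly_Mapping.lookup p (x, y) *\<^sub>C b x y)"
  unfolding free_lift_def using assms
  by (intro sum.mono_neutral_left) (auto simp: in_keys_iff)

lemma clinear_free_lift: "clinear (free_lift b)"
proof (rule clinearI)
  fix p q :: "'a \<times> 'b \<Rightarrow>\<^sub>0 complex" and c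
  let ?A = "Poly_Mapping.keys p \<union> Poly_Mapping.keys q"
  have "free_lift b (p + q) = (\<Sum>(x, y)\<in>?A. Poly_Mapping.lookup (p + q) (x, y) *\<^sub>C b x y)"
    by (rule free_lift_superset) (use Poly_Mapping.keys_add[of p q] in auto)
  also have "\<dots> = (\<Sum>(x, y)\<in>?A. Poly_Mapping.lookup p (x, y) *\<^sub>C b x y) + (\<Sum>(x, y)\<in>?A. Poly_Mapping.lookup q (x, y) *\<^sub>C b x y)"
    by (simp add: lookup_add scaleC_add_left sum.distrib case_prod_unfold)
  also have "(\<Sum>(x, y)\<in>?A. Poly_Mapping.lookup p (x, y) *\<^sub>C b x y) = free_lift b p"
    by (rule free_lift_superset[symmetric]) auto
  also have "(\<Sum>(x, y)\<in>?A. Poly_Mapping.lookup q (x, y) *\<^sub>C b x y) = free_lift b q"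
    by (rule free_lift_superset[symmetric]) auto
  finally show "free_lift b (p + q) = free_lift b p + free_lift b q" .
  have "free_lift b (c *\<^sub>C p) = (\<Sum>(x, y)\<in>Poly_Mapping.keys p. Poly_Mapping.lookup (c *\<^sub>C p) (x, y) *\<^sub>C b x y)"
    by (rule free_lift_superset) (auto simp: in_keys_iff lookup_scaleC)
  also have "\<dots> = c *\<^sub>C free_lift b p"
    by (simp add: free_lift_def lookup_scaleC cvec.scale_sum_right scaleC_complex_def case_prod_unfold)
  finally show "free_lift b (c *\<^sub>C p) = c *\<^sub>C free_lift b p" .
qed

lemma free_lift_single: "free_lift b (Poly_Mapping.single (x, y) 1) = b x y"
  by (simp add: free_lift_def scaleC_one)

lemma free_lift_relations:
  assumes b: "cbilinear b" and p: "p \<in> cvec.span tensor_relations"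
  shows "free_lift b p = 0"
proof -
  interpret L: Vector_Spaces.linear scaleC scaleC "free_lift b" by (rule clinear_free_lift)
  have l: "\<And>x. clinear (b x)" and r: "\<And>y. clinear (\<lambda>x. b x y)"
    using b by (auto simp: cbilinear_def)
  have "free_lift b q = 0" if "q \<in> tensor_relations" for q
    using that
    by cases (simp_all add: L.diff L.scale free_lift_single clinearD[OF l] clinearD[OF r])
  then show ?thesis
    using L.eq_0_on_span[OF _ p] by blast
qed

lemma tensor_lift_abs: "cbilinear b \<Longrightarrow> tensor_lift b (abs_tensor p) = free_lift b p"
proof -
  assume b: "cbilinear b"
  interpret L: Vector_Spaces.linear scaleC scaleC "free_lift b" by (rule clinear_free_lift)
  have "rep_tensor (abs_tensor p) - p \<in> cvec.span tensor_relations"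
    using Quotient3_tensor by (rule rep_abs_rsp_left) (simp add: cvec.span_zero)
  then show ?thesis
    using free_lift_relations[OF b] by (fastforce simp: tensor_lift_def L.diff)
qed

lemma tensor_lift_tens: "cbilinear b \<Longrightarrow> tensor_lift b (x \<otimes> y) = b x y"
  by (simp add: tens.abs_eq tensor_lift_abs free_lift_single)

lemma clinear_tensor_lift:
  assumes b: "cbilinear b" shows "clinear (tensor_lift b)"
proof (rule clinearI)
  fix s t :: "('a, 'b) tensor" and c
  show "tensor_lift b (s + t) = tensor_lift b s + tensor_lift b t"
    by (induct s; induct t) (simp add: plus_tensor.abs_eq tensor_lift_abs[OF b] clinearD[OF clinear_free_lift])
  show "tensor_lift b (c *\<^sub>C t) = c *\<^sub>C tensor_lift b t"
    by (induct t) (simp add: scaleC_tensor.abs_eq tensor_lift_abs[OF b] clinearD[OF clinear_free_lift])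
qed

lemma tensor_relations_span:
  "p - q - r \<in> tensor_relations \<Longrightarrow> p - (q + r) \<in> cvec.span tensor_relations"
  by (rule cvec.span_base) (simp only: diff_diff_add)

lemma cbilinear_tens: "cbilinear (\<otimes>)"
  unfolding cbilinear_def
proof (intro conjI allI clinearI)
  fix x x' :: 'a and y y' :: 'b and c
  show "x \<otimes> (y + y') = x \<otimes> y + x \<otimes> y'"
    by transfer (rule tensor_relations_span, rule tensor_relations.intros)
  show "(x + x') \<otimes> y = x \<otimes> y + x' \<otimes> y"
    by transfer (rule tensor_relations_span, rule tensor_relations.intros)
  show "x \<otimes> (c *\<^sub>C y) = c *\<^sub>C (x \<otimes> y)"
    by transfer (rule cvec.span_base, rule tensor_relations.intros)
  show "(c *\<^sub>C x) \<otimes> y = c *\<^sub>C (x \<otimes> y)"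
    by transfer (rule cvec.span_base, rule tensor_relations.intros)
qed

lemma span_tens: "cvec.span {x \<otimes> y |x y. True} = UNIV"
proof -
  have "t \<in> cvec.span {x \<otimes> y |x y. True}" for t :: "('a, 'b) tensor"
  proof (rule tensor.abs_induct)
    fix p :: "'a \<times> 'b \<Rightarrow>\<^sub>0 complex"
    show "abs_tensor p \<in> cvec.span {x \<otimes> y |x y. True}"
    proof (induct p rule: Poly_Mapping.update_induct)
      case const
      show ?case using cvec.span_zero by (simp add: zero_tensor.abs_eq[symmetric])
    next
      case (update p k v)
      have "Poly_Mapping.update k v p = p + v *\<^sub>C Poly_Mapping.single k 1"
        using update(1) by (intro poly_mapping_eqI)
          (auto simp: lookup_update lookup_add lookup_scaleC lookup_single when_def scaleC_complex_def
            in_keys_iff)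
      then have "abs_tensor (Poly_Mapping.update k v p) = abs_tensor p + v *\<^sub>C (fst k \<otimes> snd k)"
        by (simp add: plus_tensor.abs_eq scaleC_tensor.abs_eq tens.abs_eq)
      moreover have "fst k \<otimes> snd k \<in> cvec.span {x \<otimes> y |x y. True}"
        by (rule cvec.span_base) blast
      ultimately show ?case using update(3) by (simp add: cvec.span_add cvec.span_scale)
    qed
  qed
  then show ?thesis by blast
qed

lemma tensor_lift_unique:
  assumes f: "clinear f" and eq: "\<And>x y. f (x \<otimes> y) = b x y"
  shows "f = tensor_lift b"
proof -
  interpret F: Vector_Spaces.linear scaleC scaleC f by (rule f)
  have l: "clinear ((\<otimes>) x)" and r: "clinear (\<lambda>x. x \<otimes> y)" for x :: 'a and y :: 'b
    using cbilinear_tens by (auto simp: cbilinear_def)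
  have b: "cbilinear b"
    unfolding cbilinear_def
    by (intro conjI allI clinearI; unfold eq[symmetric])
      (simp_all only: clinearD[OF l] clinearD[OF r] F.add F.scale)
  interpret P: vector_space_pair "scaleC :: complex \<Rightarrow> ('a,'b) tensor \<Rightarrow> _" "scaleC :: complex \<Rightarrow> 'c \<Rightarrow> _"
    by unfold_locales
  show ?thesis
  proof
    fix t
    show "f t = tensor_lift b t"
    proof (rule P.linear_eq_on_span[OF f clinear_tensor_lift[OF b]])
      show "t \<in> cvec.span {x \<otimes> y |x y. True}" unfolding span_tens by simp
      show "f s = tensor_lift b s" if "s \<in> {x \<otimes> y |x y. True}" for s
        using that by (elim CollectE exE conjE) (simp only: eq tensor_lift_tens[OF b])
    qed
  qed
qed

definition tensor_map ::
    "('a::complex_vector \<Rightarrow> 'c::complex_vector) \<Rightarrow> ('b::complex_vector \<Rightarrow> 'd::complex_vector) \<Rightarrow>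
     ('a, 'b) tensor \<Rightarrow> ('c, 'd) tensor" where
  "tensor_map f g = tensor_lift (\<lambda>x y. f x \<otimes> g y)"

definition tensor_assoc ::
    "(('a::complex_vector, 'b::complex_vector) tensor, 'c::complex_vector) tensor \<Rightarrow>
     ('a, ('b, 'c) tensor) tensor" where
  "tensor_assoc = tensor_lift (\<lambda>t z. tensor_lift (\<lambda>x y. x \<otimes> (y \<otimes> z)) t)"

text \<open>The product \<open>(a \<otimes> b) (c \<otimes> d) = a c \<otimes> b d\<close> on the tensor square of an algebra.\<close>

definition tensor_mult ::
    "('a::complex_vector \<Rightarrow> 'a \<Rightarrow> 'a) \<Rightarrow> ('a, 'a) tensor \<Rightarrow> ('a, 'a) tensor \<Rightarrow> ('a, 'a) tensor" where
  "tensor_mult m s t = tensor_lift (\<lambda>a b. tensor_lift (\<lambda>c d. m a c \<otimes> m b d) t) s"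

section \<open>Hopf algebras\<close>

locale complex_algebra =
  fixes m :: "'a::complex_vector \<Rightarrow> 'a \<Rightarrow> 'a" and e :: 'a
  assumes cbilinear_m: "cbilinear m"
    and m_assoc: "m (m x y) z = m x (m y z)"
    and m_unit_left: "m e x = x"
    and m_unit_right: "m x e = x"

text \<open>The counit axioms use the canonical identifications of \<open>\<complex> \<otimes> C\<close> and \<open>C \<otimes> \<complex>\<close> with \<open>C\<close>.\<close>

locale complex_coalgebra =
  fixes \<Delta> :: "'a::complex_vector \<Rightarrow> ('a, 'a) tensor" and \<epsilon> :: "'a \<Rightarrow> complex"
  assumes clinear_comult: "clinear \<Delta>"
    and clinear_counit: "clinear \<epsilon>"
    and coassoc: "tensor_assoc (tensor_map \<Delta> id (\<Delta> x)) = tensor_map id \<Delta> (\<Delta> x)"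
    and counit_left: "tensor_lift (\<lambda>c y. c *\<^sub>C y) (tensor_map \<epsilon> id (\<Delta> x)) = x"
    and counit_right: "tensor_lift (\<lambda>y c. c *\<^sub>C y) (tensor_map id \<epsilon> (\<Delta> x)) = x"

locale complex_bialgebra = complex_algebra m e + complex_coalgebra \<Delta> \<epsilon>
  for m :: "'a::complex_vector \<Rightarrow> 'a \<Rightarrow> 'a" and e \<Delta> \<epsilon> +
  assumes comult_mult: "\<Delta> (m x y) = tensor_mult m (\<Delta> x) (\<Delta> y)"
    and comult_unit: "\<Delta> e = e \<otimes> e"
    and counit_mult: "\<epsilon> (m x y) = \<epsilon> x * \<epsilon> y"
    and counit_unit: "\<epsilon> e = 1"

locale hopf_algebra = complex_bialgebra m e \<Delta> \<epsilon>
  for m :: "'a::complex_vector \<Rightarrow> 'a \<Rightarrow> 'a" and e \<Delta> \<epsilon> +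
  fixes S :: "'a \<Rightarrow> 'a"
  assumes clinear_antipode: "clinear S"
    and antipode_left: "tensor_lift m (tensor_map S id (\<Delta> x)) = \<epsilon> x *\<^sub>C e"
    and antipode_right: "tensor_lift m (tensor_map id S (\<Delta> x)) = \<epsilon> x *\<^sub>C e"

section \<open>Bigradings by \<open>\<int>\<^sup>n\<close>\<close>

definition is_decomposition :: "('i \<Rightarrow> 'a::complex_vector set) \<Rightarrow> 'a \<Rightarrow> ('i \<Rightarrow> 'a) \<Rightarrow> bool" where
  "is_decomposition V x c \<longleftrightarrow>
     (\<forall>i. c i \<in> V i) \<and> finite {i. c i \<noteq> 0} \<and> x = (\<Sum>i | c i \<noteq> 0. c i)"

definition direct_sum_decomposition :: "('i \<Rightarrow> 'a::complex_vector set) \<Rightarrow> bool" where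
  "direct_sum_decomposition V \<longleftrightarrow>
     (\<forall>i. cvec.subspace (V i)) \<and> (\<forall>x. \<exists>!c. is_decomposition V x c)"

definition tensor_subspace ::
    "'a::complex_vector set \<Rightarrow> 'b::complex_vector set \<Rightarrow> ('a, 'b) tensor set" where
  "tensor_subspace U V = cvec.span {x \<otimes> y |x y. x \<in> U \<and> y \<in> V}"

text \<open>The sum in \<open>comult_graded\<close> is automatically direct, the grading of \<open>H\<close> being direct.\<close>

locale bigraded_hopf_algebra = hopf_algebra m e \<Delta> \<epsilon> S
  for m :: "'a::complex_vector \<Rightarrow> 'a \<Rightarrow> 'a" and e \<Delta> \<epsilon> S +
  fixes H :: "(int ^ 'n) \<times> (int ^ 'n) \<Rightarrow> 'a set"
  assumes direct_sum: "direct_sum_decomposition H"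
    and mult_graded: "x \<in> H (r, s) \<Longrightarrow> y \<in> H (p, q) \<Longrightarrow> m x y \<in> H (r + p, s + q)"
    and comult_graded: "x \<in> H (r, l) \<Longrightarrow>
          \<Delta> x \<in> cvec.span (\<Union>s. tensor_subspace (H (r, s)) (H (s, l)))"
    and counit_graded: "x \<in> H (r, l) \<Longrightarrow> r \<noteq> l \<Longrightarrow> \<epsilon> x = 0"
    and antipode_graded: "x \<in> H (r, l) \<Longrightarrow> S x \<in> H (- l, - r)"

definition homogeneous_part :: "('i \<Rightarrow> 'a::complex_vector set) \<Rightarrow> 'a \<Rightarrow> 'i \<Rightarrow> 'a" where
  "homogeneous_part V x = (THE c. is_decomposition V x c)"

section \<open>The deformed product\<close>

definition phase :: "real ^ 'n ^ 'n \<Rightarrow> int ^ 'n \<Rightarrow> int ^ 'n \<Rightarrow> complex" where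
  "phase \<theta> r l =
     exp (of_real pi * \<i> * of_real ((\<theta> *v (\<chi> i. real_of_int (r $ i))) \<bullet> (\<chi> i. real_of_int (l $ i))))"

text \<open>The bilinear extension, written out on homogeneous components, of
  \<open>h \<cdot>\<^sub>\<Theta> g = \<lambda>\<^sub>\<theta>(r\<^sub>1, l\<^sub>1) \<lambda>\<^sub>-\<^sub>\<theta>(r\<^sub>2, l\<^sub>2) h g\<close> for \<open>h \<in> H (r\<^sub>1, r\<^sub>2)\<close>, \<open>g \<in> H (l\<^sub>1, l\<^sub>2)\<close>; see
  \<open>deformed_mult_homogeneous\<close>. The sums are finite when \<open>H\<close> is a direct sum decomposition.\<close>

definition deformed_mult ::
    "real ^ 'n ^ 'n \<Rightarrow> ((int ^ 'n) \<times> (int ^ 'n) \<Rightarrow> 'a::complex_vector set) \<Rightarrow>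
     ('a \<Rightarrow> 'a \<Rightarrow> 'a) \<Rightarrow> 'a \<Rightarrow> 'a \<Rightarrow> 'a" where
  "deformed_mult \<theta> H m h g =
     (\<Sum>(r\<^sub>1, r\<^sub>2) | homogeneous_part H h (r\<^sub>1, r\<^sub>2) \<noteq> 0.
      \<Sum>(l\<^sub>1, l\<^sub>2) | homogeneous_part H g (l\<^sub>1, l\<^sub>2) \<noteq> 0.
        (phase \<theta> r\<^sub>1 l\<^sub>1 * phase (- \<theta>) r\<^sub>2 l\<^sub>2) *\<^sub>C
          m (homogeneous_part H h (r\<^sub>1, r\<^sub>2)) (homogeneous_part H g (l\<^sub>1, l\<^sub>2)))"

lemma is_decomposition_homogeneous_part:
  assumes "direct_sum_decomposition V"
  shows "is_decomposition V x (homogeneous_part V x)"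
proof -
  have "\<exists>!c. is_decomposition V x c" using assms unfolding direct_sum_decomposition_def by simp
  then show ?thesis unfolding homogeneous_part_def by (rule theI')
qed

lemma homogeneous_part_eqI:
  assumes "direct_sum_decomposition V" "is_decomposition V x c"
  shows "homogeneous_part V x = c"
proof -
  have "\<exists>!c. is_decomposition V x c" using assms(1) unfolding direct_sum_decomposition_def by simp
  then show ?thesis unfolding homogeneous_part_def by (rule the1_equality) (rule assms(2))
qed

lemma homogeneous_part_homogeneous:
  assumes V: "direct_sum_decomposition V" and x: "x \<in> V i"
  shows "homogeneous_part V x = (\<lambda>j. if j = i then x else 0)"
proof (rule homogeneous_part_eqI[OF V])
  have *: "{j. (if j = i then x else 0) \<noteq> 0} = (if x = 0 then {} else {i})" by auto
  have "cvec.subspace (V j)" for j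
    using V unfolding direct_sum_decomposition_def by simp
  then have zero: "0 \<in> V j" for j
    by (rule cvec.subspace_0)
  show "is_decomposition V x (\<lambda>j. if j = i then x else 0)"
    unfolding is_decomposition_def * using x zero by simp
qed

lemma (in bigraded_hopf_algebra) deformed_mult_homogeneous:
  assumes h: "h \<in> H (r\<^sub>1, r\<^sub>2)" and g: "g \<in> H (l\<^sub>1, l\<^sub>2)"
  shows "deformed_mult \<theta> H m h g = (phase \<theta> r\<^sub>1 l\<^sub>1 * phase (- \<theta>) r\<^sub>2 l\<^sub>2) *\<^sub>C m h g"
proof -
  have l: "\<And>x. clinear (m x)" and r: "\<And>y. clinear (\<lambda>x. m x y)"
    using cbilinear_m by (auto simp: cbilinear_def)
  have z: "m x 0 = 0" "m 0 x = 0" for x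
    using clinearD(1)[OF l[of x], of 0 0] clinearD(1)[OF r[of x], of 0 0] by simp_all
  have hom: "homogeneous_part H x k = (if k = i then x else 0)" if "x \<in> H i" for x i k
    using homogeneous_part_homogeneous[OF direct_sum that] by simp
  have supp: "{k. homogeneous_part H x k \<noteq> 0} = (if x = 0 then {} else {i})" if "x \<in> H i" for x i
    by (auto simp: hom[OF that])
  have "deformed_mult \<theta> H m h g =
      (\<Sum>k\<in>(if h = 0 then {} else {(r\<^sub>1, r\<^sub>2)}). \<Sum>k'\<in>(if g = 0 then {} else {(l\<^sub>1, l\<^sub>2)}).
        (phase \<theta> (fst k) (fst k') * phase (- \<theta>) (snd k) (snd k')) *\<^sub>C
          m (homogeneous_part H h k) (homogeneous_part H g k'))"
    by (simp only: deformed_mult_def case_prod_unfold prod.collapse supp[OF h] supp[OF g])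
  then show ?thesis
    by (simp add: z hom[OF h] hom[OF g])
qed

end

theory Submission
  imports Defs
begin

text \<open>
  The deformed product multiplies the product of homogeneous elements of bidegrees
  \<open>i = (r\<^sub>1, r\<^sub>2)\<close> and \<open>j = (l\<^sub>1, l\<^sub>2)\<close> by a number \<open>\<sigma> i j\<close> that depends only on the bidegrees, and
  \<open>\<sigma>\<close> is multiplicative in each argument. In particular \<open>\<sigma>\<close> is a normalized 2-cocycle on the
  group of bidegrees, so twisting by it preserves associativity; the unit survives because it has
  degree 0 (\<open>unit_homogeneous\<close>).

  The compatibility with the coalgebra structure comes from the shape
  \<open>\<sigma> (r\<^sub>1, r\<^sub>2) (l\<^sub>1, l\<^sub>2) = \<lambda>(r\<^sub>1, l\<^sub>1) / \<lambda>(r\<^sub>2, l\<^sub>2)\<close> with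
  \<open>\<lambda> = phase \<theta>\<close>, which telescopes along the coproduct: if
  \<open>a \<otimes> b\<close> occurs in \<open>\<Delta> x\<close> and \<open>c \<otimes> d\<close> occurs in \<open>\<Delta> y\<close>, then \<open>a\<close> and \<open>b\<close> share an inner degree
  \<open>s\<close>, \<open>c\<close> and \<open>d\<close> share an inner degree \<open>t\<close>, and the factors \<open>\<lambda>(s, t)\<close> from \<open>a c\<close> and \<open>b d\<close>
  cancel. What remains is the factor by which \<open>x y\<close> itself is deformed
  (\<open>tensor_mult_deformed\<close>). The counit vanishes off the diagonal bidegrees \<open>(r, r)\<close>, where
  \<open>\<sigma>\<close> is 1.

  For the antipode, the inner degree enters only through \<open>\<lambda>(s, s)\<close>, which is 1 because \<open>\<theta>\<close> is
  skew-symmetric. Hence the deformed convolution of \<open>S\<close> and the identity, evaluated at \<open>x\<close> of bidegree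
  \<open>(r, l)\<close>, is a scalar \<open>\<lambda>(\<plusminus>r, l)\<close> times \<open>\<epsilon> x *\<^sub>C e\<close>. That scalar is 1 for \<open>r = l\<close>, again by
  skew-symmetry, and \<open>\<epsilon> x = 0\<close> otherwise. All identities extend from homogeneous elements by linearity.
\<close>

section \<open>Linear and bilinear maps\<close>

lemma clinear_compose: "clinear f \<Longrightarrow> clinear g \<Longrightarrow> clinear (\<lambda>x. f (g x))"
  by (rule clinearI) (simp_all add: clinearD)

lemma clinear_scaleC: "clinear f \<Longrightarrow> clinear (\<lambda>x. c *\<^sub>C f x)"
  by (rule clinearI) (simp_all add: clinearD scaleC_add_right scaleC_scaleC mult.commute)

lemma clinear_ident: "clinear (\<lambda>x. x)"
  by (rule clinearI) simp_all

lemma clinear_id: "clinear id"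
  unfolding id_def by (rule clinear_ident)

lemma clinear_eq_on_span:
  fixes f g :: "'a::complex_vector \<Rightarrow> 'b::complex_vector"
  assumes "clinear f" "clinear g" "\<And>x. x \<in> B \<Longrightarrow> f x = g x" "x \<in> cvec.span B"
  shows "f x = g x"
proof -
  interpret vector_space_pair "scaleC :: complex \<Rightarrow> 'a \<Rightarrow> _" "scaleC :: complex \<Rightarrow> 'b \<Rightarrow> _"
    by unfold_locales
  show ?thesis
    using linear_eq_on_span[OF assms(1,2)] assms(3,4) by blast
qed

lemma clinear_sum:
  fixes f :: "'a::complex_vector \<Rightarrow> 'b::complex_vector"
  assumes "clinear f"
  shows "f (\<Sum>i\<in>A. g i) = (\<Sum>i\<in>A. f (g i))"
proof -
  interpret Vector_Spaces.linear scaleC scaleC f by fact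
  show ?thesis by (rule sum)
qed

lemma clinear_0: "clinear f \<Longrightarrow> f 0 = 0"
  using clinearD(1)[of f 0 0] by simp

lemma cbilinearI:
  assumes "\<And>x. clinear (b x)" "\<And>y. clinear (\<lambda>x. b x y)"
  shows "cbilinear b"
  using assms by (simp add: cbilinear_def)

lemma cbilinearD:
  assumes "cbilinear b"
  shows "clinear (b x)" "clinear (\<lambda>x. b x y)"
  using assms by (simp_all add: cbilinear_def)

lemma cbilinear_scaleC: "cbilinear b \<Longrightarrow> cbilinear (\<lambda>x y. c *\<^sub>C b x y)"
  by (intro cbilinearI clinear_scaleC) (simp_all add: cbilinear_def)

lemma cbilinear_compose:
  assumes "cbilinear b" "clinear f" "clinear g"
  shows "cbilinear (\<lambda>x y. b (f x) (g y))"
  by (rule cbilinearI)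
    (rule clinear_compose[OF cbilinearD(1)[OF assms(1)] assms(3)],
      rule clinear_compose[OF cbilinearD(2)[OF assms(1)] assms(2)])

lemmas tens_clinear = cbilinearD[OF cbilinear_tens]

lemma tensor_lift_add: "tensor_lift (\<lambda>x y. b x y + b' x y) t = tensor_lift b t + tensor_lift b' t"
  by (simp add: tensor_lift_def free_lift_def scaleC_add_right sum.distrib case_prod_unfold)

lemma tensor_lift_scaleC: "tensor_lift (\<lambda>x y. c *\<^sub>C b x y) t = c *\<^sub>C tensor_lift b t"
  by (simp add: tensor_lift_def free_lift_def scaleC_scaleC cvec.scale_sum_right case_prod_unfold
      mult.commute)

text \<open>For fixed \<open>t\<close>, \<open>tensor_lift b t\<close> is a finite linear combination of values of \<open>b\<close>, with
  coefficients taken from the chosen representative of \<open>t\<close>; so it depends linearly on \<open>b\<close>.\<close>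

lemma clinear_tensor_lift_family:
  assumes "\<And>x y. clinear (\<lambda>a. b a x y)"
  shows "clinear (\<lambda>a. tensor_lift (b a) t)"
proof (rule clinearI)
  fix a a' c
  have "b (a + a') = (\<lambda>x y. b a x y + b a' x y)" "b (c *\<^sub>C a) = (\<lambda>x y. c *\<^sub>C b a x y)"
    using clinearD[OF assms] by (auto intro!: ext)
  then show "tensor_lift (b (a + a')) t = tensor_lift (b a) t + tensor_lift (b a') t"
    "tensor_lift (b (c *\<^sub>C a)) t = c *\<^sub>C tensor_lift (b a) t"
    by (simp_all add: tensor_lift_add tensor_lift_scaleC)
qed

lemma tensor_map_tens:
  assumes "clinear f" "clinear g"
  shows "tensor_map f g (x \<otimes> y) = f x \<otimes> g y"
  unfolding tensor_map_def
  by (rule tensor_lift_tens) (rule cbilinear_compose[OF cbilinear_tens assms])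

lemma clinear_tensor_map: "clinear f \<Longrightarrow> clinear g \<Longrightarrow> clinear (tensor_map f g)"
  unfolding tensor_map_def
  by (intro clinear_tensor_lift cbilinear_compose[OF cbilinear_tens])

context
  fixes m :: "'a::complex_vector \<Rightarrow> 'a \<Rightarrow> 'a"
  assumes m: "cbilinear m"
begin

lemma cbilinear_tensor_mult_inner: "cbilinear (\<lambda>c d. m a c \<otimes> m b d)"
  by (intro cbilinear_compose[OF cbilinear_tens] cbilinearD[OF m])

lemma cbilinear_tensor_mult_outer: "cbilinear (\<lambda>a b. tensor_lift (\<lambda>c d. m a c \<otimes> m b d) t)"
  by (intro cbilinearI clinear_tensor_lift_family
      clinear_compose[OF tens_clinear(1)] clinear_compose[OF tens_clinear(2)] cbilinearD[OF m])

lemma tensor_mult_tens: "tensor_mult m (a \<otimes> b) (c \<otimes> d) = m a c \<otimes> m b d"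
  unfolding tensor_mult_def
  by (rule trans[OF tensor_lift_tens[OF cbilinear_tensor_mult_outer]
        tensor_lift_tens[OF cbilinear_tensor_mult_inner]])

lemma cbilinear_tensor_mult: "cbilinear (tensor_mult m)"
proof (rule cbilinearI)
  show "clinear (\<lambda>s. tensor_mult m s t)" for t
    unfolding tensor_mult_def by (rule clinear_tensor_lift[OF cbilinear_tensor_mult_outer])
  show "clinear (tensor_mult m s)" for s
    unfolding tensor_mult_def
    by (intro clinear_tensor_lift_family clinear_tensor_lift[OF cbilinear_tensor_mult_inner])
qed

end

section \<open>Homogeneous components\<close>

definition support :: "('i \<Rightarrow> 'a::complex_vector set) \<Rightarrow> 'a \<Rightarrow> 'i set" where
  "support V x = {i. homogeneous_part V x i \<noteq> 0}"

lemma is_decomposition_superset: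
  assumes "\<And>i. c i \<in> V i" "finite A" "{i. c i \<noteq> 0} \<subseteq> A" "x = (\<Sum>i\<in>A. c i)"
  shows "is_decomposition V x c"
  unfolding is_decomposition_def
proof (intro conjI allI)
  show "finite {i. c i \<noteq> 0}" using assms(2,3) finite_subset by blast
  show "x = (\<Sum>i | c i \<noteq> 0. c i)"
    unfolding assms(4) using assms(2,3) by (intro sum.mono_neutral_right) auto
qed (rule assms(1))

context
  fixes V :: "'i \<Rightarrow> 'a::complex_vector set"
  assumes V: "direct_sum_decomposition V"
begin

lemma homogeneous_part_in: "homogeneous_part V x i \<in> V i"
  using is_decomposition_homogeneous_part[OF V, of x] by (simp add: is_decomposition_def)

lemma finite_support: "finite (support V x)"
  using is_decomposition_homogeneous_part[OF V, of x] by (simp add: is_decomposition_def support_def)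

lemma sum_homogeneous_part:
  assumes "finite A" "support V x \<subseteq> A"
  shows "x = (\<Sum>i\<in>A. homogeneous_part V x i)"
proof -
  have "x = (\<Sum>i\<in>support V x. homogeneous_part V x i)"
    using is_decomposition_homogeneous_part[OF V, of x] by (simp add: is_decomposition_def support_def)
  also have "\<dots> = (\<Sum>i\<in>A. homogeneous_part V x i)"
    using assms by (intro sum.mono_neutral_left) (auto simp: support_def)
  finally show ?thesis .
qed

lemma clinear_homogeneous_part: "clinear (\<lambda>x. homogeneous_part V x i)"
proof (rule clinearI)
  have sub: "cvec.subspace (V j)" for j
    using V by (simp add: direct_sum_decomposition_def)
  fix x y :: 'a and c
  let ?A = "support V x \<union> support V y"
  have "homogeneous_part V (x + y) = (\<lambda>i. homogeneous_part V x i + homogeneous_part V y i)"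
  proof (rule homogeneous_part_eqI[OF V], rule is_decomposition_superset)
    show "finite ?A" by (simp add: finite_support)
    show "homogeneous_part V x j + homogeneous_part V y j \<in> V j" for j
      by (intro cvec.subspace_add sub homogeneous_part_in)
    show "x + y = (\<Sum>i\<in>?A. homogeneous_part V x i + homogeneous_part V y i)"
      unfolding sum.distrib
      by (intro arg_cong2[where f = "(+)"] sum_homogeneous_part) (auto simp: finite_support)
  qed (auto simp: support_def)
  then show "homogeneous_part V (x + y) i = homogeneous_part V x i + homogeneous_part V y i"
    by simp
  have "homogeneous_part V (c *\<^sub>C x) = (\<lambda>i. c *\<^sub>C homogeneous_part V x i)"
  proof (rule homogeneous_part_eqI[OF V], rule is_decomposition_superset)
    show "finite (support V x)" by (rule finite_support)
    show "c *\<^sub>C homogeneous_part V x j \<in> V j" for j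
      by (intro cvec.subspace_scale sub homogeneous_part_in)
    show "c *\<^sub>C x = (\<Sum>i\<in>support V x. c *\<^sub>C homogeneous_part V x i)"
      unfolding cvec.scale_sum_right[symmetric]
      by (intro arg_cong2[where f = scaleC] sum_homogeneous_part) (auto simp: finite_support)
  qed (auto simp: support_def)
  then show "homogeneous_part V (c *\<^sub>C x) i = c *\<^sub>C homogeneous_part V x i"
    by simp
qed

lemma clinear_eq_homogeneous:
  fixes f g :: "'a \<Rightarrow> 'b::complex_vector"
  assumes f: "clinear f" and g: "clinear g" and eq: "\<And>i x. x \<in> V i \<Longrightarrow> f x = g x"
  shows "f x = g x"
proof (rule clinear_eq_on_span[OF f g])
  show "f y = g y" if "y \<in> (\<Union>i. V i)" for y using that eq by blast
  have "(\<Sum>i\<in>support V x. homogeneous_part V x i) \<in> cvec.span (\<Union>i. V i)"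
    by (intro cvec.span_sum cvec.span_base) (use homogeneous_part_in in blast)
  then show "x \<in> cvec.span (\<Union>i. V i)"
    using sum_homogeneous_part[of "support V x" x] by (simp add: finite_support)
qed

lemma cbilinear_eq_homogeneous:
  fixes f g :: "'a \<Rightarrow> 'a \<Rightarrow> 'b::complex_vector"
  assumes f: "cbilinear f" and g: "cbilinear g"
    and eq: "\<And>i j x y. x \<in> V i \<Longrightarrow> y \<in> V j \<Longrightarrow> f x y = g x y"
  shows "f x y = g x y"
proof -
  have "f x y = g x y" if "x \<in> V i" for x i
    by (rule clinear_eq_homogeneous[OF cbilinearD(1)[OF f] cbilinearD(1)[OF g] eq[OF that]])
  then show ?thesis
    by (rule clinear_eq_homogeneous[OF cbilinearD(2)[OF f] cbilinearD(2)[OF g]])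
qed

end

section \<open>Twisting a graded algebra by a normalized 2-cocycle\<close>

definition twisted_mult ::
    "('i \<Rightarrow> 'i \<Rightarrow> complex) \<Rightarrow> ('i \<Rightarrow> 'a::complex_vector set) \<Rightarrow> ('a \<Rightarrow> 'a \<Rightarrow> 'a) \<Rightarrow> 'a \<Rightarrow> 'a \<Rightarrow> 'a" where
  "twisted_mult \<sigma> V m x y = (\<Sum>i\<in>support V x. \<Sum>j\<in>support V y.
     \<sigma> i j *\<^sub>C m (homogeneous_part V x i) (homogeneous_part V y j))"

locale graded_algebra = complex_algebra m e
  for m :: "'a::complex_vector \<Rightarrow> 'a \<Rightarrow> 'a" and e +
  fixes V :: "'i::group_add \<Rightarrow> 'a set"
  assumes direct_sum: "direct_sum_decomposition V"
    and mult_graded: "x \<in> V i \<Longrightarrow> y \<in> V j \<Longrightarrow> m x y \<in> V (i + j)"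
begin

lemmas m_clinear = cbilinearD[OF cbilinear_m]

lemma homogeneous_part_eq: "x \<in> V i \<Longrightarrow> homogeneous_part V x j = (if j = i then x else 0)"
  using homogeneous_part_homogeneous[OF direct_sum] by metis

lemma support_homogeneous: "x \<in> V i \<Longrightarrow> support V x \<subseteq> {i}"
  by (auto simp: support_def homogeneous_part_eq split: if_splits)

text \<open>Comparing the components of degree \<open>j\<close> in \<open>x = e x\<close> for \<open>x\<close> of degree \<open>j\<close> shows that the component
  of degree 0 of \<open>e\<close> is already a left unit, and left and right units agree.\<close>

lemma unit_homogeneous: "e \<in> V 0"
proof -
  let ?e = "homogeneous_part V e"
  have left_unit: "m (?e 0) x = x" if x: "x \<in> V j" for j x
  proof -
    have "x = homogeneous_part V (m e x) j"
      by (simp add: m_unit_left homogeneous_part_eq[OF x])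
    also have "m e x = (\<Sum>i\<in>insert 0 (support V e). m (?e i) x)"
      using sum_homogeneous_part[OF direct_sum, of "insert 0 (support V e)" e]
        clinear_sum[OF m_clinear(2)[of x]] finite_support[OF direct_sum]
      by (metis finite_insert subset_insertI)
    also have "homogeneous_part V \<dots> j = (\<Sum>i\<in>insert 0 (support V e). homogeneous_part V (m (?e i) x) j)"
      by (rule clinear_sum[OF clinear_homogeneous_part[OF direct_sum]])
    also have "\<dots> = (\<Sum>i\<in>insert 0 (support V e). if i = 0 then m (?e 0) x else 0)"
    proof (intro sum.cong refl)
      fix i
      have "j = i + j \<longleftrightarrow> i = 0" by (metis add_0 add_right_cancel)
      then show "homogeneous_part V (m (?e i) x) j = (if i = 0 then m (?e 0) x else 0)"
        by (simp add: homogeneous_part_eq[OF mult_graded[OF homogeneous_part_in[OF direct_sum] x]])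
    qed
    also have "\<dots> = m (?e 0) x"
      by (simp add: finite_support[OF direct_sum])
    finally show ?thesis by simp
  qed
  have "m (?e 0) e = e"
    by (rule clinear_eq_homogeneous[OF direct_sum m_clinear(1) clinear_ident left_unit])
  then show ?thesis
    using homogeneous_part_in[OF direct_sum, of e 0] by (simp add: m_unit_right)
qed

lemma twisted_mult_superset:
  assumes A: "finite A" "support V x \<subseteq> A" and B: "finite B" "support V y \<subseteq> B"
  shows "twisted_mult \<sigma> V m x y =
    (\<Sum>i\<in>A. \<Sum>j\<in>B. \<sigma> i j *\<^sub>C m (homogeneous_part V x i) (homogeneous_part V y j))"
proof -
  have "(\<Sum>j\<in>support V y. \<sigma> i j *\<^sub>C m (homogeneous_part V x i) (homogeneous_part V y j)) =
      (\<Sum>j\<in>B. \<sigma> i j *\<^sub>C m (homogeneous_part V x i) (homogeneous_part V y j))" for i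
    using B by (intro sum.mono_neutral_left) (auto simp: support_def clinear_0[OF m_clinear(1)])
  then show ?thesis
    unfolding twisted_mult_def using A
    by (simp, intro sum.mono_neutral_left) (auto simp: support_def clinear_0[OF m_clinear(2)])
qed

lemma twisted_mult_homogeneous:
  assumes "x \<in> V i" "y \<in> V j"
  shows "twisted_mult \<sigma> V m x y = \<sigma> i j *\<^sub>C m x y"
  by (subst twisted_mult_superset[of "{i}" _ "{j}"])
    (simp_all add: support_homogeneous assms homogeneous_part_eq[OF assms(1)]
      homogeneous_part_eq[OF assms(2)])

lemma cbilinear_twisted_mult: "cbilinear (twisted_mult \<sigma> V m)"
proof (intro cbilinearI clinearI)
  \<comment> \<open>\<open>?A\<close> and \<open>?B\<close> contain all the supports involved, so that every product below is a sum over one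
    index set.\<close>
  fix x x' y y' :: 'a and c
  note hom = clinearD[OF clinear_homogeneous_part[OF direct_sum]]
  note fin = finite_support[OF direct_sum]
  note simps = hom clinearD[OF m_clinear(1)] clinearD[OF m_clinear(2)] scaleC_add_right
    scaleC_scaleC mult.commute cvec.scale_sum_right sum.distrib
  let ?A = "support V x \<union> support V x' \<union> support V (x + x') \<union> support V (c *\<^sub>C x)"
  let ?B = "support V y \<union> support V y' \<union> support V (y + y') \<union> support V (c *\<^sub>C y)"
  have eq: "twisted_mult \<sigma> V m u v =
      (\<Sum>i\<in>?A. \<Sum>j\<in>?B. \<sigma> i j *\<^sub>C m (homogeneous_part V u i) (homogeneous_part V v j))"
    if "u \<in> {x, x', x + x', c *\<^sub>C x}" "v \<in> {y, y', y + y', c *\<^sub>C y}" for u v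
    by (rule twisted_mult_superset) (use that in \<open>auto simp: fin\<close>)
  show "twisted_mult \<sigma> V m x (y + y') = twisted_mult \<sigma> V m x y + twisted_mult \<sigma> V m x y'"
    "twisted_mult \<sigma> V m x (c *\<^sub>C y) = c *\<^sub>C twisted_mult \<sigma> V m x y"
    "twisted_mult \<sigma> V m (x + x') y = twisted_mult \<sigma> V m x y + twisted_mult \<sigma> V m x' y"
    "twisted_mult \<sigma> V m (c *\<^sub>C x) y = c *\<^sub>C twisted_mult \<sigma> V m x y"
    by (simp_all add: eq simps)
qed

text \<open>On homogeneous elements the two bracketings of a triple product acquire the factors on the two sides
  of the cocycle identity, and normalization makes multiplication by the degree 0 element \<open>e\<close> acquire
  the factor 1.\<close>

theorem complex_algebra_twisted_mult:
  assumes cocycle: "\<And>i j k. \<sigma> i j * \<sigma> (i + j) k = \<sigma> i (j + k) * \<sigma> j k"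
    and normalized: "\<And>i. \<sigma> 0 i = 1" "\<And>i. \<sigma> i 0 = 1"
  shows "complex_algebra (twisted_mult \<sigma> V m) e"
proof
  let ?m = "twisted_mult \<sigma> V m"
  show "cbilinear ?m" by (rule cbilinear_twisted_mult)
  note lin = cbilinearD[OF this]
  note comp = clinear_compose[OF lin(1)] clinear_compose[OF lin(2)]
  show "?m e x = x" for x
    by (rule clinear_eq_homogeneous[OF direct_sum lin(1) clinear_ident])
      (simp add: twisted_mult_homogeneous[OF unit_homogeneous] normalized scaleC_one m_unit_left)
  show "?m x e = x" for x
    by (rule clinear_eq_homogeneous[OF direct_sum lin(2) clinear_ident])
      (simp add: twisted_mult_homogeneous[OF _ unit_homogeneous] normalized scaleC_one m_unit_right)
  have hom: "?m (?m x y) z = ?m x (?m y z)" if "x \<in> V i" "y \<in> V j" "z \<in> V k" for x y z i j k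
  proof -
    have "?m (?m x y) z = (\<sigma> i j * \<sigma> (i + j) k) *\<^sub>C m (m x y) z"
      by (simp add: twisted_mult_homogeneous[OF that(1,2)] clinearD[OF lin(2)] scaleC_scaleC
          twisted_mult_homogeneous[OF mult_graded[OF that(1,2)] that(3)])
    moreover have "?m x (?m y z) = (\<sigma> i (j + k) * \<sigma> j k) *\<^sub>C m x (m y z)"
      by (simp add: twisted_mult_homogeneous[OF that(2,3)] clinearD[OF lin(1)] scaleC_scaleC
          twisted_mult_homogeneous[OF that(1) mult_graded[OF that(2,3)]] mult.commute)
    ultimately show ?thesis by (simp add: cocycle m_assoc)
  qed
  have "?m (?m x y) z = ?m x (?m y z)" if "z \<in> V k" for x y z k
    by (rule cbilinear_eq_homogeneous[where f = "\<lambda>x y. ?m (?m x y) z" and g = "\<lambda>x y. ?m x (?m y z)",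
          OF direct_sum _ _ hom[OF _ _ that]])
      (intro cbilinearI lin comp)+
  then show "?m (?m x y) z = ?m x (?m y z)" for x y z
    by (rule clinear_eq_homogeneous[OF direct_sum lin(1) comp(1)[OF lin(1)]])
qed

end

section \<open>The phase as a bicharacter\<close>

lemma phase_add_left: "phase \<theta> (r + r') l = phase \<theta> r l * phase \<theta> r' l"
proof -
  have "(\<chi> i. real_of_int ((r + r') $ i)) = (\<chi> i. real_of_int (r $ i)) + (\<chi> i. real_of_int (r' $ i))"
    by (simp add: vec_eq_iff)
  then show ?thesis
    by (simp add: phase_def matrix_vector_right_distrib inner_add_left exp_add[symmetric]
        distrib_left)
qed

lemma phase_add_right: "phase \<theta> r (l + l') = phase \<theta> r l * phase \<theta> r l'"
proof -
  have "(\<chi> i. real_of_int ((l + l') $ i)) = (\<chi> i. real_of_int (l $ i)) + (\<chi> i. real_of_int (l' $ i))"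
    by (simp add: vec_eq_iff)
  then show ?thesis
    by (simp add: phase_def inner_add_right exp_add[symmetric] distrib_left)
qed

lemma phase_nonzero: "phase \<theta> r l \<noteq> 0"
  by (simp add: phase_def)

lemma phase_0: "phase \<theta> 0 l = 1" "phase \<theta> r 0 = 1"
  using phase_add_left[of \<theta> 0 0 l] phase_add_right[of \<theta> r 0 0] by (simp_all add: phase_nonzero)

lemma phase_minus_matrix: "phase (- \<theta>) r l = inverse (phase \<theta> r l)"
proof -
  have "(- \<theta>) *v u = - (\<theta> *v u)" for u :: "real ^ 'a"
    by (simp add: matrix_vector_mult_def vec_eq_iff sum_negf)
  then show ?thesis by (simp add: phase_def exp_minus)
qed

lemma phase_minus: "phase \<theta> (- r) l = inverse (phase \<theta> r l)" "phase \<theta> r (- l) = inverse (phase \<theta> r l)"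
  using phase_add_left[of \<theta> r "- r" l] phase_add_right[of \<theta> r l "- l"]
  by (simp_all add: phase_0 inverse_unique[symmetric])

lemma phase_diagonal:
  assumes "transpose \<theta> = - \<theta>"
  shows "phase \<theta> r r = 1"
proof -
  have "(\<theta> *v u) \<bullet> u = 0" for u
  proof -
    have "(\<theta> *v u) \<bullet> u = u \<bullet> (transpose \<theta> *v u)"
      by (metis dot_lmul_matrix inner_commute transpose_matrix_vector)
    also have "transpose \<theta> *v u = - (\<theta> *v u)"
      by (simp add: assms matrix_vector_mult_def vec_eq_iff sum_negf)
    finally show ?thesis by (simp add: inner_commute)
  qed
  then show ?thesis by (simp add: phase_def)
qed

text \<open>The bicharacter \<open>\<lambda>\<^sub>\<Theta>\<close> on the group of bidegrees, for \<open>\<Theta>\<close> the block matrix with diagonal blocks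
  \<open>\<theta>\<close> and \<open>- \<theta>\<close>.\<close>

definition biphase :: "real ^ 'n ^ 'n \<Rightarrow> (int ^ 'n) \<times> (int ^ 'n) \<Rightarrow> (int ^ 'n) \<times> (int ^ 'n) \<Rightarrow> complex" where
  "biphase \<theta> i j = phase \<theta> (fst i) (fst j) * phase (- \<theta>) (snd i) (snd j)"

lemma deformed_mult_eq_twisted_mult: "deformed_mult \<theta> H m = twisted_mult (biphase \<theta>) H m"
  by (intro ext) (simp add: deformed_mult_def twisted_mult_def biphase_def support_def case_prod_unfold)

section \<open>The deformed Hopf algebra\<close>

context bigraded_hopf_algebra
begin

lemma graded_algebra: "graded_algebra m e H"
proof
  show "direct_sum_decomposition H" by (rule direct_sum)
  show "m x y \<in> H (i + j)" if "x \<in> H i" "y \<in> H j" for x y i j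
    using that mult_graded[of x "fst i" "snd i" y "fst j" "snd j"] by (simp add: plus_prod_def)
qed

lemma complex_algebra_deformed: "complex_algebra (deformed_mult \<theta> H m) e"
proof -
  interpret graded: graded_algebra m e H by (rule graded_algebra)
  show ?thesis
    unfolding deformed_mult_eq_twisted_mult
    by (rule graded.complex_algebra_twisted_mult)
      (simp_all add: biphase_def phase_add_left phase_add_right phase_0)
qed

lemma cbilinear_deformed: "cbilinear (deformed_mult \<theta> H m)"
  using complex_algebra_deformed complex_algebra.cbilinear_m by blast

text \<open>The generators of the space in which the coproduct of an element of bidegree \<open>(r, l)\<close> lies.\<close>

definition composable_tensors :: "int ^ 'n \<Rightarrow> int ^ 'n \<Rightarrow> ('a, 'a) tensor set" where
  "composable_tensors r l = {a \<otimes> b |a b s. a \<in> H (r, s) \<and> b \<in> H (s, l)}"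

lemma comult_composable:
  assumes "x \<in> H (r, l)"
  shows "\<Delta> x \<in> cvec.span (composable_tensors r l)"
proof -
  have "tensor_subspace (H (r, s)) (H (s, l)) \<subseteq> cvec.span (composable_tensors r l)" for s
    unfolding tensor_subspace_def composable_tensors_def by (rule cvec.span_mono) blast
  then have "cvec.span (\<Union>s. tensor_subspace (H (r, s)) (H (s, l))) \<subseteq> cvec.span (composable_tensors r l)"
    by (intro cvec.span_minimal cvec.subspace_span) blast
  then show ?thesis using comult_graded[OF assms] by blast
qed

text \<open>The two products of tensor factors carry the phases of their inner degrees to opposite powers,
  so the deformed product on the tensor square depends on the outer degrees only.\<close>

lemma tensor_mult_deformed:
  assumes u: "u \<in> cvec.span (composable_tensors r\<^sub>1 r\<^sub>2)"
    and v: "v \<in> cvec.span (composable_tensors l\<^sub>1 l\<^sub>2)"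
  shows "tensor_mult (deformed_mult \<theta> H m) u v =
    (phase \<theta> r\<^sub>1 l\<^sub>1 * phase (- \<theta>) r\<^sub>2 l\<^sub>2) *\<^sub>C tensor_mult m u v"
proof -
  let ?m = "deformed_mult \<theta> H m" and ?c = "phase \<theta> r\<^sub>1 l\<^sub>1 * phase (- \<theta>) r\<^sub>2 l\<^sub>2"
  note lin = cbilinearD[OF cbilinear_tensor_mult[OF cbilinear_deformed]]
    cbilinearD[OF cbilinear_scaleC[OF cbilinear_tensor_mult[OF cbilinear_m]]]
  have gen: "tensor_mult ?m s t = ?c *\<^sub>C tensor_mult m s t"
    if s: "s \<in> composable_tensors r\<^sub>1 r\<^sub>2" and t: "t \<in> composable_tensors l\<^sub>1 l\<^sub>2" for s t
  proof -
    obtain a b p where ab: "s = a \<otimes> b" "a \<in> H (r\<^sub>1, p)" "b \<in> H (p, r\<^sub>2)"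
      using s unfolding composable_tensors_def by blast
    obtain c d q where cd: "t = c \<otimes> d" "c \<in> H (l\<^sub>1, q)" "d \<in> H (q, l\<^sub>2)"
      using t unfolding composable_tensors_def by blast
    have "tensor_mult ?m s t = ?m a c \<otimes> ?m b d"
      by (simp add: ab(1) cd(1) tensor_mult_tens[OF cbilinear_deformed])
    also have "\<dots> = ((phase \<theta> r\<^sub>1 l\<^sub>1 * phase (- \<theta>) p q) * (phase \<theta> p q * phase (- \<theta>) r\<^sub>2 l\<^sub>2)) *\<^sub>C
        (m a c \<otimes> m b d)"
      by (simp add: deformed_mult_homogeneous[OF ab(2) cd(2)] deformed_mult_homogeneous[OF ab(3) cd(3)]
          clinearD[OF tens_clinear(1)] clinearD[OF tens_clinear(2)] scaleC_scaleC mult.commute)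
    also have "(phase \<theta> r\<^sub>1 l\<^sub>1 * phase (- \<theta>) p q) * (phase \<theta> p q * phase (- \<theta>) r\<^sub>2 l\<^sub>2) = ?c"
      by (simp add: phase_minus_matrix phase_nonzero)
    finally show ?thesis
      by (simp add: ab(1) cd(1) tensor_mult_tens[OF cbilinear_m])
  qed
  have "tensor_mult ?m s v = ?c *\<^sub>C tensor_mult m s v" if "s \<in> composable_tensors r\<^sub>1 r\<^sub>2" for s
    by (rule clinear_eq_on_span[OF lin(1,3) gen[OF that] v])
  then show ?thesis
    by (rule clinear_eq_on_span[OF lin(2,4) _ u])
qed

lemma comult_deformed_mult:
  "\<Delta> (deformed_mult \<theta> H m x y) = tensor_mult (deformed_mult \<theta> H m) (\<Delta> x) (\<Delta> y)"
proof -
  let ?m = "deformed_mult \<theta> H m"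
  note lin = cbilinearD[OF cbilinear_deformed]
  have hom: "\<Delta> (?m x y) = tensor_mult ?m (\<Delta> x) (\<Delta> y)" if "x \<in> H i" "y \<in> H j" for i j x y
  proof -
    obtain r\<^sub>1 r\<^sub>2 l\<^sub>1 l\<^sub>2 where "i = (r\<^sub>1, r\<^sub>2)" "j = (l\<^sub>1, l\<^sub>2)"
      by (cases i, cases j) blast
    with that have *: "x \<in> H (r\<^sub>1, r\<^sub>2)" "y \<in> H (l\<^sub>1, l\<^sub>2)" by simp_all
    show ?thesis
      by (simp add: deformed_mult_homogeneous[OF *] clinearD[OF clinear_comult] comult_mult
          tensor_mult_deformed[OF comult_composable[OF *(1)] comult_composable[OF *(2)]])
  qed
  have "cbilinear (\<lambda>x y. \<Delta> (?m x y))"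
    by (intro cbilinearI clinear_compose[OF clinear_comult] lin)
  moreover have "cbilinear (\<lambda>x y. tensor_mult ?m (\<Delta> x) (\<Delta> y))"
    by (rule cbilinear_compose[OF cbilinear_tensor_mult[OF cbilinear_deformed] clinear_comult clinear_comult])
  ultimately show ?thesis
    by (rule cbilinear_eq_homogeneous[OF direct_sum _ _ hom])
qed

lemma counit_deformed_mult: "\<epsilon> (deformed_mult \<theta> H m x y) = \<epsilon> x * \<epsilon> y"
proof -
  let ?m = "deformed_mult \<theta> H m"
  note lin = cbilinearD[OF cbilinear_deformed]
  have mult_clinear: "clinear (\<lambda>x. \<epsilon> x * a)" "clinear (\<lambda>x. a * \<epsilon> x)" for a
    by (rule clinearI; simp add: clinearD[OF clinear_counit] scaleC_complex_def algebra_simps)+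
  have hom: "\<epsilon> (?m x y) = \<epsilon> x * \<epsilon> y" if "x \<in> H i" "y \<in> H j" for i j x y
  proof -
    obtain r\<^sub>1 r\<^sub>2 l\<^sub>1 l\<^sub>2 where "i = (r\<^sub>1, r\<^sub>2)" "j = (l\<^sub>1, l\<^sub>2)"
      by (cases i, cases j) blast
    with that have *: "x \<in> H (r\<^sub>1, r\<^sub>2)" "y \<in> H (l\<^sub>1, l\<^sub>2)" by simp_all
    have "\<epsilon> (?m x y) = (phase \<theta> r\<^sub>1 l\<^sub>1 * phase (- \<theta>) r\<^sub>2 l\<^sub>2) * (\<epsilon> x * \<epsilon> y)"
      by (simp add: deformed_mult_homogeneous[OF *] clinearD[OF clinear_counit] counit_mult
          scaleC_complex_def)
    then show ?thesis
      using counit_graded[OF *(1)] counit_graded[OF *(2)]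
      by (cases "r\<^sub>1 = r\<^sub>2"; cases "l\<^sub>1 = l\<^sub>2") (simp_all add: phase_minus_matrix phase_nonzero)
  qed
  show ?thesis
    by (rule cbilinear_eq_homogeneous[where f = "\<lambda>x y. \<epsilon> (?m x y)" and g = "\<lambda>x y. \<epsilon> x * \<epsilon> y",
          OF direct_sum _ _ hom])
      (intro cbilinearI lin mult_clinear clinear_compose[OF clinear_counit])+
qed

text \<open>A convolution \<open>f * g\<close> evaluated at an element of bidegree \<open>(r, l)\<close> is only rescaled by the
  deformation, provided the scalar does not depend on the inner degree of the coproduct.\<close>

lemma convolution_deformed:
  assumes f: "clinear f" and g: "clinear g" and x: "x \<in> H (r, l)"
    and scalar: "\<And>a b s. a \<in> H (r, s) \<Longrightarrow> b \<in> H (s, l) \<Longrightarrow>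
      deformed_mult \<theta> H m (f a) (g b) = c *\<^sub>C m (f a) (g b)"
  shows "tensor_lift (deformed_mult \<theta> H m) (tensor_map f g (\<Delta> x)) =
    c *\<^sub>C tensor_lift m (tensor_map f g (\<Delta> x))"
proof (rule clinear_eq_on_span[OF _ _ _ comult_composable[OF x]])
  show "clinear (\<lambda>t. tensor_lift (deformed_mult \<theta> H m) (tensor_map f g t))"
    "clinear (\<lambda>t. c *\<^sub>C tensor_lift m (tensor_map f g t))"
    by (intro clinear_scaleC clinear_compose[OF clinear_tensor_lift] clinear_tensor_map f g
        cbilinear_deformed cbilinear_m)+
  fix t assume "t \<in> composable_tensors r l"
  then show "tensor_lift (deformed_mult \<theta> H m) (tensor_map f g t) =
      c *\<^sub>C tensor_lift m (tensor_map f g t)"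
    unfolding composable_tensors_def using scalar
    by (auto simp: tensor_map_tens[OF f g] tensor_lift_tens cbilinear_deformed cbilinear_m)
qed

lemma antipode_deformed:
  assumes skew: "transpose \<theta> = - \<theta>"
  shows "tensor_lift (deformed_mult \<theta> H m) (tensor_map S id (\<Delta> x)) = \<epsilon> x *\<^sub>C e" (is "?L x = _")
    and "tensor_lift (deformed_mult \<theta> H m) (tensor_map id S (\<Delta> x)) = \<epsilon> x *\<^sub>C e" (is "?R x = _")
proof -
  note diag = phase_diagonal[OF skew]
  have clinear_LR: "clinear ?L" "clinear ?R"
    by (intro clinear_compose[OF clinear_tensor_lift[OF cbilinear_deformed]]
        clinear_compose[OF clinear_tensor_map] clinear_antipode clinear_id clinear_comult)+
  have clinear_eps: "clinear (\<lambda>x. \<epsilon> x *\<^sub>C e)"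
    by (rule clinearI)
      (simp_all add: clinearD[OF clinear_counit] scaleC_add_left scaleC_scaleC scaleC_complex_def)
  have scalar: "c *\<^sub>C (\<epsilon> x *\<^sub>C e) = \<epsilon> x *\<^sub>C e" if "x \<in> H (r, l)" "r = l \<Longrightarrow> c = 1" for x r l c
    using that counit_graded[OF that(1)] by (cases "r = l") (simp_all add: scaleC_one)
  have "?L x = \<epsilon> x *\<^sub>C e" if "x \<in> H i" for x i
  proof (cases i)
    case (Pair r l)
    with that have x: "x \<in> H (r, l)" by simp
    \<comment> \<open>\<open>S a\<close> and \<open>b\<close> have bidegrees \<open>(- s, - r)\<close> and \<open>(s, l)\<close>.\<close>
    have "?L x = phase \<theta> r l *\<^sub>C tensor_lift m (tensor_map S id (\<Delta> x))"
      by (rule convolution_deformed[OF clinear_antipode clinear_id x])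
        (simp add: deformed_mult_homogeneous[OF antipode_graded] phase_minus phase_minus_matrix diag)
    then show ?thesis
      using scalar[OF x] by (simp add: antipode_left diag)
  qed
  then show "?L x = \<epsilon> x *\<^sub>C e"
    by (rule clinear_eq_homogeneous[OF direct_sum clinear_LR(1) clinear_eps])
  have "?R x = \<epsilon> x *\<^sub>C e" if "x \<in> H i" for x i
  proof (cases i)
    case (Pair r l)
    with that have x: "x \<in> H (r, l)" by simp
    \<comment> \<open>\<open>a\<close> and \<open>S b\<close> have bidegrees \<open>(r, s)\<close> and \<open>(- l, - s)\<close>.\<close>
    have "?R x = phase \<theta> r (- l) *\<^sub>C tensor_lift m (tensor_map id S (\<Delta> x))"
      by (rule convolution_deformed[OF clinear_id clinear_antipode x])
        (simp add: deformed_mult_homogeneous[OF _ antipode_graded] phase_minus phase_minus_matrix diag)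
    then show ?thesis
      using scalar[OF x] by (simp add: antipode_right phase_minus diag)
  qed
  then show "?R x = \<epsilon> x *\<^sub>C e"
    by (rule clinear_eq_homogeneous[OF direct_sum clinear_LR(2) clinear_eps])
qed

end

theorem proposition4p7:
  fixes m :: "'a::complex_vector \<Rightarrow> 'a \<Rightarrow> 'a" and e :: 'a
    and \<Delta> :: "'a \<Rightarrow> ('a, 'a) tensor" and \<epsilon> :: "'a \<Rightarrow> complex" and S :: "'a \<Rightarrow> 'a"
    and H :: "(int ^ 'n) \<times> (int ^ 'n) \<Rightarrow> 'a set"
    and \<theta> :: "real ^ 'n ^ 'n"
  assumes "bigraded_hopf_algebra m e \<Delta> \<epsilon> S H"
    and "transpose \<theta> = - \<theta>"
  shows "hopf_algebra (deformed_mult \<theta> H m) e \<Delta> \<epsilon> S"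
proof -
  interpret bigraded_hopf_algebra m e \<Delta> \<epsilon> S H by fact
  show ?thesis
    by (intro hopf_algebra.intro complex_bialgebra.intro complex_bialgebra_axioms.intro
        hopf_algebra_axioms.intro)
      (fact complex_algebra_deformed complex_coalgebra_axioms comult_deformed_mult comult_unit
        counit_deformed_mult counit_unit clinear_antipode antipode_deformed[OF assms(2)])+
qed

end
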